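(* For every $p\le 1/2$ (with $p\ge0$) there is an infinite sequence of edge-weighted bipartite graphs $G_1,G_2,\dots$ with increasing number of vertices such that the competitive-ratio $\mathrm{E}[\mathrm{ALG}]/\mathrm{E}[\mathrm{OPT}]$ of the $\mathrm{AOS}p$ greedy-based algorithm on $G_k$ approaches $p(1-p)$ as $k\to\infty$.
   Context: $\mathrm{AOS}p$ model for bipartite matching with vertex arrivals: (1) The adversary generates a finite bipartite graph $G=(L,R,E)$ with weights $w:E\to\mathbb{R}_{\ge0}$ (ties broken by a fixed consistent rule, so edge weights are totally ordered). (2) Each $u\in L$ is put in the history set $H$ independently with probability $p$; the value $p$ and the subgraph induced on $H\cup R$ are given to the online player upfront. The online set is $O=L\setminus H$. (3) The vertices of $O$ arrive one by one in an adversarial order (which may depend on $H$). When a vertex arrives, its incident edges and their weights are revealed, and the player must immediately and irrevocably match it to an unmatched neighbor or leave it unmatched. For $U\subseteq L$, $G[U]$ denotes the subgraph induced on $U\cup R$. $\mathrm{OPT}$ is the (random) maximum weight of a matching in $G[O]$; $\mathrm{ALG}$ is the weight of the output matching; expectations are over $H$. The competitive-ratio on a graph is taken with respect to the adversarial (worst-case) arrival order. $\mathrm{Greedy}(K)$: process the edges of $K$ in non-increasing order of weight, adding an edge to the matching iff neither endpoint is already covered. $\mathrm{AOS}p$ greedy-based algorithm: set $L'=H$, $M=\emptyset$. When $u\in O$ arrives, compute $\mathrm{Greedy}(G[L'\cup\{u\}])$; if $u$ is matched in it by an edge $(u,r)$ and $r$ is not yet matched in $M$, add $(u,r)$ to $M$.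 Output $M$. *)

theory Defs
  imports "HOL-Probability.Probability" "HOL-Combinatorics.Multiset_Permutations"
begin

section \<open>Edge-weighted bipartite graphs\<close>

text \<open>
  The two sides are taken from two separate types, so they are disjoint by construction, also
  when \<^typ>\<open>'a\<close> and \<^typ>\<open>'b\<close> are instantiated to the same type. An edge is a pair
  (left endpoint, right endpoint).
\<close>

record ('a, 'b) wbgraph =
  lverts :: "'a set"
  rverts :: "'b set"
  edges :: "('a \<times> 'b) set"
  weight :: "'a \<times> 'b \<Rightarrow> real"

definition weighted_bipartite :: "('a, 'b) wbgraph \<Rightarrow> bool" where
  "weighted_bipartite G \<longleftrightarrow>
     finite (lverts G) \<and> finite (rverts G) \<and> edges G \<subseteq> lverts G \<times> rverts G \<and>
     (\<forall>e\<in>edges G. 0 \<le> weight G e)"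

definition num_verts :: "('a, 'b) wbgraph \<Rightarrow> nat" where
  "num_verts G = card (lverts G) + card (rverts G)"

text \<open>The subgraph induced on \<open>U\<close> together with all right vertices.\<close>

definition induced :: "('a, 'b) wbgraph \<Rightarrow> 'a set \<Rightarrow> ('a, 'b) wbgraph" where
  "induced G U = G\<lparr>lverts := lverts G \<inter> U, edges := {e \<in> edges G. fst e \<in> U}\<rparr>"

definition matching :: "('a, 'b) wbgraph \<Rightarrow> ('a \<times> 'b) set \<Rightarrow> bool" where
  "matching G M \<longleftrightarrow> M \<subseteq> edges G \<and> inj_on fst M \<and> inj_on snd M"

definition max_matching_weight :: "('a, 'b) wbgraph \<Rightarrow> real" where
  "max_matching_weight G = Max {sum (weight G) M | M. matching G M}"


section \<open>The greedy matching\<close>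

text \<open>
  The tie-breaking rule is a linear order \<open>tb\<close> on edges: among edges of equal weight, \<open>e\<close> is
  processed before \<open>f\<close> if \<open>(e, f) \<in> tb\<close>.
\<close>

definition precedes ::
    "('e \<times> 'e) set \<Rightarrow> ('e \<Rightarrow> real) \<Rightarrow> 'e \<Rightarrow> 'e \<Rightarrow> bool" where
  "precedes tb w e f \<longleftrightarrow> w f < w e \<or> (w f = w e \<and> e \<noteq> f \<and> (e, f) \<in> tb)"

definition processing_order ::
    "('e \<times> 'e) set \<Rightarrow> ('e \<Rightarrow> real) \<Rightarrow> 'e set \<Rightarrow> 'e list" where
  "processing_order tb w E = (THE es. set es = E \<and> sorted_wrt (precedes tb w) es)"

definition greedy_step :: "'a \<times> 'b \<Rightarrow> ('a \<times> 'b) set \<Rightarrow> ('a \<times> 'b) set" where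
  "greedy_step e M = (if fst e \<notin> fst ` M \<and> snd e \<notin> snd ` M then insert e M else M)"

definition greedy ::
    "(('a \<times> 'b) \<times> ('a \<times> 'b)) set \<Rightarrow> ('a, 'b) wbgraph \<Rightarrow> ('a \<times> 'b) set" where
  "greedy tb K = fold greedy_step (processing_order tb (weight K) (edges K)) {}"

text \<open>The processing order is well defined.\<close>

lemma processing_order_ex1:
  assumes "finite E" "linear_order tb"
  shows "\<exists>!es. set es = E \<and> sorted_wrt (precedes tb w) es"
proof -
  have irr: "\<not> precedes tb w e e" for e
    by (simp add: precedes_def)
  have "antisym tb" "trans tb" and tot: "total tb"
    using assms(2) by (auto simp: linear_order_on_def partial_order_on_def preorder_on_def)
  have tr: "precedes tb w e g" if "precedes tb w e f" "precedes tb w f g" for e f g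
    using that \<open>antisym tb\<close> \<open>trans tb\<close> unfolding precedes_def
    by (auto dest: antisymD transD)
  have total: "precedes tb w e f \<or> precedes tb w f e" if "e \<noteq> f" for e f
    using that tot unfolding precedes_def total_on_def by fastforce
  have ex: "\<exists>es. set es = E \<and> sorted_wrt (precedes tb w) es"
    using assms(1)
  proof induction
    case (insert e E)
    then obtain es where es: "set es = E" "sorted_wrt (precedes tb w) es" by blast
    let ?es = "filter (\<lambda>x. precedes tb w x e) es @ e # filter (precedes tb w e) es"
    have "set ?es = insert e E"
      using es insert.hyps total by auto
    moreover have "sorted_wrt (precedes tb w) ?es"
      using es by (auto simp: sorted_wrt_append sorted_wrt_filter intro: tr)
    ultimately show ?case by blast
  qed simp
  have uniq: "xs = ys"
    if "set xs = set ys" "sorted_wrt (precedes tb w) xs" "sorted_wrt (precedes tb w) ys" for xs ys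
    using that
  proof (induction xs arbitrary: ys)
    case (Cons x xs)
    then obtain y ys' where ys: "ys = y # ys'" by (cases ys) auto
    have "x = y"
    proof (rule ccontr)
      assume "x \<noteq> y"
      then have "y \<in> set xs" "x \<in> set ys'" using Cons.prems(1) ys by auto
      then have "precedes tb w x y" "precedes tb w y x" using Cons.prems ys by auto
      then show False using tr irr by blast
    qed
    moreover have "x \<notin> set xs" "y \<notin> set ys'" using Cons.prems(2,3) ys irr by auto
    ultimately have "set xs = set ys'" using Cons.prems(1) ys by auto
    then show ?case using Cons \<open>x = y\<close> ys by auto
  qed simp
  show ?thesis using ex uniq by blast
qed


section \<open>The online algorithm\<close>

text \<open>
  The second operand of the union below has at most one element, since \<^const>\<open>greedy\<close> returns
  a matching; \<open>H\<close> is the history set, and it is not extended by the arrived vertices.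
\<close>

definition online_step ::
    "(('a \<times> 'b) \<times> ('a \<times> 'b)) set \<Rightarrow> ('a, 'b) wbgraph \<Rightarrow> 'a set
      \<Rightarrow> 'a \<Rightarrow> ('a \<times> 'b) set \<Rightarrow> ('a \<times> 'b) set" where
  "online_step tb G H u M =
     M \<union> {e \<in> greedy tb (induced G (insert u H)). fst e = u \<and> snd e \<notin> snd ` M}"

definition alg_matching ::
    "(('a \<times> 'b) \<times> ('a \<times> 'b)) set \<Rightarrow> ('a, 'b) wbgraph \<Rightarrow> 'a set
      \<Rightarrow> 'a list \<Rightarrow> ('a \<times> 'b) set" where
  "alg_matching tb G H us = fold (online_step tb G H) us {}"


section \<open>Competitive ratio\<close>

definition history_pmf :: "real \<Rightarrow> ('a, 'b) wbgraph \<Rightarrow> 'a set pmf" where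
  "history_pmf p G =
     map_pmf (\<lambda>f. {u \<in> lverts G. f u}) (Pi_pmf (lverts G) False (\<lambda>_. bernoulli_pmf p))"

text \<open>An adversary chooses, for every history set, an arrival order of the online vertices.\<close>

definition adversaries :: "('a, 'b) wbgraph \<Rightarrow> ('a set \<Rightarrow> 'a list) set" where
  "adversaries G = (\<Pi>\<^sub>E H\<in>Pow (lverts G). permutations_of_set (lverts G - H))"

definition expected_alg ::
    "(('a \<times> 'b) \<times> ('a \<times> 'b)) set \<Rightarrow> real \<Rightarrow> ('a, 'b) wbgraph
      \<Rightarrow> ('a set \<Rightarrow> 'a list) \<Rightarrow> real" where
  "expected_alg tb p G \<sigma> =
     measure_pmf.expectation (history_pmf p G) (\<lambda>H. sum (weight G) (alg_matching tb G H (\<sigma> H)))"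

definition expected_opt :: "real \<Rightarrow> ('a, 'b) wbgraph \<Rightarrow> real" where
  "expected_opt p G =
     measure_pmf.expectation (history_pmf p G) (\<lambda>H. max_matching_weight (induced G (lverts G - H)))"

text \<open>For finite \<open>G\<close> there are finitely many adversaries, so the minimum exists.\<close>

definition competitive_ratio ::
    "(('a \<times> 'b) \<times> ('a \<times> 'b)) set \<Rightarrow> real \<Rightarrow> ('a, 'b) wbgraph \<Rightarrow> real" where
  "competitive_ratio tb p G = (MIN \<sigma>\<in>adversaries G. expected_alg tb p G \<sigma> / expected_opt p G)"

lemma finite_adversaries: "finite (lverts G) \<Longrightarrow> finite (adversaries G)"
  unfolding adversaries_def by (intro finite_PiE) auto

lemma adversaries_nonempty: "finite (lverts G) \<Longrightarrow> adversaries G \<noteq> {}"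
  unfolding adversaries_def by (auto simp: PiE_eq_empty_iff)

end

theory Submission
  imports Defs "HOL-Real_Asymp.Real_Asymp"
begin

text \<open>
  The extremal graph has left vertices \<open>u\<^sub>0, \<dots>, u\<^sub>n\<^sub>-\<^sub>1\<close> and slightly more than \<open>p n\<close> right
  vertices called cores. Every \<open>u\<^sub>i\<close> is adjacent to all cores and to a private right vertex, and
  every core has a block of further left neighbours of its own. All weights are nearly \<open>1\<close>; the
  edges at \<open>u\<^sub>0\<close> come first, then those at \<open>u\<^sub>1\<close>, and so on, each \<open>u\<^sub>i\<close> preferring earlier cores
  and its private vertex last.

  Greedy on the history set together with an online \<open>u\<^sub>i\<close> matches \<open>u\<^sub>i\<close> to the core whose index is
  the number of history vertices below \<open>i\<close>. Hence the algorithm covers one core for each maximal run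
  of online vertices, which are about \<open>p (1 - p) n\<close> in number. By Chebyshev's inequality the cores
  are nearly all used up by the history vertices, so private vertices and blocks contribute only
  \<open>o(n)\<close> to the output. An offline matching however uses the private vertices for the online \<open>u\<^sub>i\<close>
  and the blocks for the cores, and has weight about \<open>(1 - p) n + p n = n\<close>.
\<close>

section \<open>Greedy matchings and the online algorithm\<close>

text \<open>An edge is rejected only when an edge processed earlier, hence at least as heavy,
  already covers one of its endpoints.\<close>

lemma fold_greedy_step_stable:
  fixes w :: "'a \<times> 'b \<Rightarrow> real"
  assumes "sorted_wrt (precedes tb w) es"
  shows "fold greedy_step es {} \<subseteq> set es \<and>
    inj_on fst (fold greedy_step es {}) \<and> inj_on snd (fold greedy_step es {}) \<and>
    (\<forall>e\<in>set es. \<exists>f\<in>fold greedy_step es {}. w e \<le> w f \<and> (fst f = fst e \<or> snd f = snd e))"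
  using assms
proof (induction es rule: rev_induct)
  case (snoc e es)
  define M where "M = fold greedy_step es {}"
  have srt: "sorted_wrt (precedes tb w) es" and le: "\<forall>f\<in>set es. w e \<le> w f"
    using snoc.prems by (simp add: sorted_wrt_append, fastforce simp: sorted_wrt_append precedes_def)
  have IH: "M \<subseteq> set es" "inj_on fst M" "inj_on snd M"
    "\<forall>e\<in>set es. \<exists>f\<in>M. w e \<le> w f \<and> (fst f = fst e \<or> snd f = snd e)"
    using snoc.IH[OF srt] by (auto simp: M_def)
  have fold_eq: "fold greedy_step (es @ [e]) {} = greedy_step e M" by (simp add: M_def)
  show ?case
  proof (cases "fst e \<notin> fst ` M \<and> snd e \<notin> snd ` M")
    case True
    then have "fold greedy_step (es @ [e]) {} = insert e M"
      unfolding fold_eq by (simp add: greedy_step_def)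
    with IH True show ?thesis by (auto simp: inj_on_insert)
  next
    case False
    then have eq: "fold greedy_step (es @ [e]) {} = M"
      unfolding fold_eq by (auto simp: greedy_step_def)
    from False obtain f where "f \<in> M" "fst f = fst e \<or> snd f = snd e" by force
    with IH le have "\<exists>f\<in>M. w e \<le> w f \<and> (fst f = fst e \<or> snd f = snd e)" by blast
    with IH show ?thesis unfolding eq by auto
  qed
qed simp

text \<open>Later arguments about \<open>greedy\<close> rest on these four properties alone, which
  hold for every linear tie-breaking order.\<close>

lemma greedy_stable:
  assumes "finite (edges K)" "linear_order tb"
  shows greedy_subset: "greedy tb K \<subseteq> edges K"
    and inj_on_fst_greedy: "inj_on fst (greedy tb K)"
    and inj_on_snd_greedy: "inj_on snd (greedy tb K)"
    and greedy_blocking: "\<And>e. e \<in> edges K \<Longrightarrow>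
      \<exists>f\<in>greedy tb K. weight K e \<le> weight K f \<and> (fst f = fst e \<or> snd f = snd e)"
proof -
  define es where "es = processing_order tb (weight K) (edges K)"
  have es: "set es = edges K" "sorted_wrt (precedes tb (weight K)) es"
    using theI'[OF processing_order_ex1[OF assms]]
    unfolding es_def processing_order_def by blast+
  have "greedy tb K = fold greedy_step es {}" by (simp add: greedy_def es_def)
  with fold_greedy_step_stable[OF es(2)] es(1)
  show "greedy tb K \<subseteq> edges K" "inj_on fst (greedy tb K)" "inj_on snd (greedy tb K)"
    "\<And>e. e \<in> edges K \<Longrightarrow>
      \<exists>f\<in>greedy tb K. weight K e \<le> weight K f \<and> (fst f = fst e \<or> snd f = snd e)"
    by auto
qed

text \<open>The partial matching is ignored here, so the set depends on \<open>H\<close> and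
  \<open>u\<close> but not on the arrival order.\<close>

definition candidates ::
    "(('a \<times> 'b) \<times> ('a \<times> 'b)) set \<Rightarrow> ('a, 'b) wbgraph \<Rightarrow> 'a set \<Rightarrow> 'a \<Rightarrow> ('a \<times> 'b) set" where
  "candidates tb G H u = {e \<in> greedy tb (induced G (insert u H)). fst e = u}"

lemma finite_edges: "weighted_bipartite G \<Longrightarrow> finite (edges G)"
  unfolding weighted_bipartite_def by (meson finite_SigmaI finite_subset)

lemma edges_induced: "edges (induced G U) = {e \<in> edges G. fst e \<in> U}"
  by (simp add: induced_def)

lemma weight_induced [simp]: "weight (induced G U) = weight G"
  by (simp add: induced_def)

text \<open>
  Every right vertex wanted by some arriving vertex ends up matched, whatever the order, so the
  adversary influences the weight of the output but not its cardinality.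
\<close>

lemma alg_matching_properties:
  assumes "weighted_bipartite G" "linear_order tb"
  shows "alg_matching tb G H us \<subseteq> edges G"
    and "inj_on snd (alg_matching tb G H us)"
    and "snd ` alg_matching tb G H us = (\<Union>u\<in>set us. snd ` candidates tb G H u)"
proof -
  define A where "A = alg_matching tb G H"
  have fin: "finite (edges (induced G U))" for U
    using finite_edges[OF assms(1)] by (simp add: edges_induced)
  have cand: "e = f" if "e \<in> candidates tb G H u" "f \<in> candidates tb G H u" for e f u
    using that inj_on_fst_greedy[OF fin assms(2)] unfolding candidates_def inj_on_def by auto
  have "A us \<subseteq> edges G \<and> inj_on snd (A us) \<and>
      snd ` A us = (\<Union>u\<in>set us. snd ` candidates tb G H u)"
  proof (induction us rule: rev_induct)
    case (snoc u us)
    have eq: "A (us @ [u]) = A us \<union> {e \<in> candidates tb G H u. snd e \<notin> snd ` A us}"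
      by (auto simp: A_def alg_matching_def online_step_def candidates_def)
    have "candidates tb G H u \<subseteq> edges G"
      using greedy_subset[OF fin assms(2)] unfolding candidates_def edges_induced by blast
    moreover have "inj_on snd (A (us @ [u]))"
    proof (rule inj_onI)
      fix e f assume "e \<in> A (us @ [u])" "f \<in> A (us @ [u])" "snd e = snd f"
      with snoc.IH cand[of e u f] show "e = f"
        unfolding eq inj_on_def by (metis (lifting) UnE image_eqI mem_Collect_eq)
    qed
    moreover have "snd ` A (us @ [u]) = snd ` A us \<union> snd ` candidates tb G H u"
      unfolding eq by blast
    ultimately show ?case using snoc.IH by (auto simp: eq)
  qed (simp add: A_def alg_matching_def)
  then show "alg_matching tb G H us \<subseteq> edges G" "inj_on snd (alg_matching tb G H us)"
    "snd ` alg_matching tb G H us = (\<Union>u\<in>set us. snd ` candidates tb G H u)"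
    by (auto simp: A_def)
qed

lemma card_alg_matching:
  assumes "weighted_bipartite G" "linear_order tb"
  shows "card (alg_matching tb G H us) = card (\<Union>u\<in>set us. snd ` candidates tb G H u)"
  using alg_matching_properties(2,3)[OF assms] by (metis card_image)

section \<open>Expectations over the history set\<close>

lemma finite_set_history_pmf:
  assumes "finite (lverts G)"
  shows "finite (set_pmf (history_pmf p G))"
  by (rule finite_subset[of _ "Pow (lverts G)"]) (auto simp: history_pmf_def assms)

lemma integrable_history_pmf:
  fixes f :: "'a set \<Rightarrow> real"
  assumes "finite (lverts G)"
  shows "integrable (measure_pmf (history_pmf p G)) f"
  by (intro integrable_measure_pmf_finite finite_set_history_pmf assms)

text \<open>By independence the expectation factors over single vertices. The moments and
  probabilities of the history set needed below all derive from this formula.\<close>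

lemma expectation_history_pattern:
  assumes "finite (lverts G)" "0 \<le> p" "p \<le> 1"
    and "A \<subseteq> lverts G" "B \<subseteq> lverts G" "A \<inter> B = {}"
  shows "measure_pmf.expectation (history_pmf p G) (\<lambda>H. of_bool (A \<subseteq> H \<and> B \<inter> H = {}))
    = p ^ card A * (1 - p) ^ card B"
proof -
  \<comment> \<open>\<open>g x\<close> is the factor of the indicator that depends on vertex
    \<open>x\<close> alone.\<close>
  define g :: "'a \<Rightarrow> bool \<Rightarrow> real" where
    "g x b = (if x \<in> A then of_bool b else if x \<in> B then of_bool (\<not> b) else 1)" for x b
  have fin: "finite A" "finite B" using assms by (auto intro: finite_subset)
  have "of_bool (A \<subseteq> {u \<in> lverts G. f u} \<and> B \<inter> {u \<in> lverts G. f u} = {})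
      = (\<Prod>x\<in>lverts G. g x (f x))" for f
  proof (cases "A \<subseteq> {u \<in> lverts G. f u} \<and> B \<inter> {u \<in> lverts G. f u} = {}")
    case True
    then have "(\<Prod>x\<in>lverts G. g x (f x)) = 1"
      by (intro prod.neutral) (auto simp: g_def)
    with True show ?thesis by simp
  next
    case False
    then have "\<exists>x\<in>lverts G. g x (f x) = 0"
      using assms by (auto simp: g_def)
    with False assms(1) show ?thesis by (simp add: prod_zero)
  qed
  then have "measure_pmf.expectation (history_pmf p G) (\<lambda>H. of_bool (A \<subseteq> H \<and> B \<inter> H = {}))
      = measure_pmf.expectation (Pi_pmf (lverts G) False (\<lambda>_. bernoulli_pmf p))
          (\<lambda>f. \<Prod>x\<in>lverts G. g x (f x))"
    by (simp add: history_pmf_def)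
  also have "\<dots> = (\<Prod>x\<in>lverts G. measure_pmf.expectation (bernoulli_pmf p) (g x))"
    by (intro expectation_prod_Pi_pmf assms integrable_measure_pmf_finite) (auto simp: g_def)
  also have "\<dots> = (\<Prod>x\<in>lverts G. if x \<in> A then p else if x \<in> B then 1 - p else 1)"
    using assms by (intro prod.cong refl) (auto simp: g_def)
  also have "\<dots> = (\<Prod>x\<in>A \<union> B. if x \<in> A then p else if x \<in> B then 1 - p else 1)"
    using assms by (intro prod.mono_neutral_right) auto
  also have "\<dots> = (\<Prod>x\<in>A. if x \<in> A then p else if x \<in> B then 1 - p else 1)
      * (\<Prod>x\<in>B. if x \<in> A then p else if x \<in> B then 1 - p else 1)"
    using fin assms(6) by (rule prod.union_disjoint)
  also have "(\<Prod>x\<in>B. if x \<in> A then p else if x \<in> B then 1 - p else 1) = (\<Prod>x\<in>B. 1 - p)"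
    using assms(6) by (intro prod.cong refl) auto
  finally show ?thesis by simp
qed

text \<open>Binomial variance: the square expands into a double sum whose off-diagonal terms vanish
  by pairwise independence.\<close>

lemma history_variance:
  fixes p :: real
  assumes "finite (lverts G)" "0 \<le> p" "p \<le> 1" "U \<subseteq> lverts G"
  shows "measure_pmf.expectation (history_pmf p G) (\<lambda>H. (real (card (H \<inter> U)) - p * card U)\<^sup>2)
    = card U * (p * (1 - p))"
proof -
  let ?E = "measure_pmf.expectation (history_pmf p G) :: ('a set \<Rightarrow> real) \<Rightarrow> real"
  note int = integrable_history_pmf[OF assms(1), of p]
  have finU: "finite U" using assms by (auto intro: finite_subset)
  have one: "?E (\<lambda>H. of_bool (i \<in> H)) = p" if "i \<in> U" for i
    using expectation_history_pattern[of G p "{i}" "{}"] that assms by auto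
  have two: "?E (\<lambda>H. of_bool (i \<in> H) * of_bool (j \<in> H)) = (if i = j then p else p\<^sup>2)"
    if "i \<in> U" "j \<in> U" for i j
  proof -
    have "?E (\<lambda>H. of_bool (i \<in> H) * of_bool (j \<in> H)) = ?E (\<lambda>H. of_bool ({i, j} \<subseteq> H \<and> {} \<inter> H = {}))"
      by (intro Bochner_Integration.integral_cong) auto
    also have "\<dots> = p ^ card {i, j}"
      using that assms by (subst expectation_history_pattern) auto
    finally show ?thesis by (simp add: power2_eq_square)
  qed
  have sq: "(real (card (H \<inter> U)) - p * card U)\<^sup>2
     = (\<Sum>i\<in>U. \<Sum>j\<in>U. of_bool (i \<in> H) * of_bool (j \<in> H) - p * of_bool (i \<in> H) - p * of_bool (j \<in> H) + p\<^sup>2)" for H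
  proof -
    have "real (card (H \<inter> U)) - p * card U = (\<Sum>i\<in>U. of_bool (i \<in> H) - p)"
      using finU by (simp add: sum_subtractf of_bool_def sum.If_cases Int_commute mult.commute)
    then show ?thesis
      by (simp only: power2_eq_square sum_product) (simp add: algebra_simps)
  qed
  have "?E (\<lambda>H. (real (card (H \<inter> U)) - p * card U)\<^sup>2)
    = (\<Sum>i\<in>U. \<Sum>j\<in>U. ?E (\<lambda>H. of_bool (i \<in> H) * of_bool (j \<in> H) - p * of_bool (i \<in> H)
        - p * of_bool (j \<in> H) + p\<^sup>2))"
    unfolding sq by (subst Bochner_Integration.integral_sum[OF int])
      (intro sum.cong refl Bochner_Integration.integral_sum int)
  also have "\<dots> = (\<Sum>i\<in>U. \<Sum>j\<in>U. if i = j then p * (1 - p) else 0)"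
  proof (intro sum.cong refl)
    fix i j assume "i \<in> U" "j \<in> U"
    then have "?E (\<lambda>H. of_bool (i \<in> H) * of_bool (j \<in> H) - p * of_bool (i \<in> H)
        - p * of_bool (j \<in> H) + p\<^sup>2) = (if i = j then p else p\<^sup>2) - p * p - p * p + p\<^sup>2"
      unfolding Bochner_Integration.integral_add[OF int int]
        Bochner_Integration.integral_diff[OF int int] integral_mult_right_zero
      by (simp only: one two) simp
    then show "?E (\<lambda>H. of_bool (i \<in> H) * of_bool (j \<in> H) - p * of_bool (i \<in> H)
        - p * of_bool (j \<in> H) + p\<^sup>2) = (if i = j then p * (1 - p) else 0)"
      by (simp add: power2_eq_square algebra_simps split: if_splits)
  qed
  finally show ?thesis using finU by simp
qed

lemma expectation_card_Collect:
  assumes "finite (lverts G)" "finite A"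
  shows "measure_pmf.expectation (history_pmf p G) (\<lambda>H. real (card {i \<in> A. P i H}))
    = (\<Sum>i\<in>A. measure_pmf.expectation (history_pmf p G) (\<lambda>H. of_bool (P i H)))"
proof -
  have "real (card {i \<in> A. P i H}) = (\<Sum>i\<in>A. of_bool (P i H))" for H
    using assms(2) by (simp add: of_bool_def sum.If_cases Int_def)
  then show ?thesis
    using integrable_history_pmf[OF assms(1)] by (simp only: Bochner_Integration.integral_sum)
qed

lemma expectation_history_mono:
  fixes f g :: "'a set \<Rightarrow> real"
  assumes "finite (lverts G)" "\<And>H. H \<subseteq> lverts G \<Longrightarrow> f H \<le> g H"
  shows "measure_pmf.expectation (history_pmf p G) f \<le> measure_pmf.expectation (history_pmf p G) g"
proof (rule integral_mono_AE)
  show "AE H in measure_pmf (history_pmf p G). f H \<le> g H"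
    using assms(2) by (auto simp: AE_measure_pmf_iff history_pmf_def)
qed (simp_all add: integrable_history_pmf assms(1))

section \<open>The extremal graph\<close>

text \<open>Discrete intermediate value: the count starts at 0 and rises by one exactly on passing
  an element of \<open>K\<close>, so the step from \<open>j\<close> to \<open>j + 1\<close> happens
  at such an element.\<close>

lemma ex_card_below:
  assumes "j < card (K \<inter> {..<i::nat})"
  shows "\<exists>i'\<in>K. i' < i \<and> card (K \<inter> {..<i'}) = j"
  using assms
proof (induction i)
  case (Suc i)
  have "K \<inter> {..<Suc i} = (if i \<in> K then insert i (K \<inter> {..<i}) else K \<inter> {..<i})"
    by (auto simp: less_Suc_eq)
  then have "card (K \<inter> {..<Suc i}) = (if i \<in> K then Suc (card (K \<inter> {..<i})) else card (K \<inter> {..<i}))"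
    by simp
  with Suc show ?case
    by (metis less_Suc_eq)
qed simp

lemma card_below_strict_mono:
  assumes "i' \<in> K" "i' < (i::nat)"
  shows "card (K \<inter> {..<i'}) < card (K \<inter> {..<i})"
  using assms by (intro psubset_card_mono) auto

text \<open>\<open>n\<close> counts the vertices \<open>u\<^sub>i\<close>, \<open>m\<close> the
  cores and \<open>s\<close> the vertices of each block; \<open>\<delta>\<close> bounds the excess
  of a weight over 1. Right vertices below \<open>m\<close> are the cores, and \<open>m + i\<close>
  is private to \<open>i\<close>.\<close>

locale core_graph =
  fixes n m s :: nat and \<delta> :: real
  assumes delta_pos: "0 < \<delta>"
begin

definition block :: "nat \<Rightarrow> nat set" where
  "block j = {n + j * s..<n + Suc j * s}"

text \<open>The denominator encodes left endpoint and rank lexicographically in base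
  \<open>Suc m\<close>; \<open>min\<close> gives every private vertex the rank \<open>m\<close>,
  behind all cores. Edges of the graph at vertices below \<open>n\<close> get distinct weights above
  1, so only block edges can tie.\<close>

definition wt :: "nat \<times> nat \<Rightarrow> real" where
  "wt e = (if fst e < n then 1 + \<delta> / real (Suc (fst e * Suc m + min (snd e) m)) else 1)"

definition G :: "(nat, nat) wbgraph" where
  "G = \<lparr>lverts = {..<n + m * s}, rverts = {..<m + n},
    edges = {(i, j). i < n \<and> (j < m \<or> j = m + i)} \<union> {(x, j). j < m \<and> x \<in> block j},
    weight = wt\<rparr>"

text \<open>The right vertex that greedy gives to \<open>i\<close> on the vertices \<open>K\<close>:
  each earlier vertex of \<open>K\<close> takes one core while cores last, and the private vertex is
  the fallback.\<close>

definition target :: "nat set \<Rightarrow> nat \<Rightarrow> nat" where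
  "target K i = (if card (K \<inter> {..<i}) < m then card (K \<inter> {..<i}) else m + i)"

text \<open>Last vertices of the maximal runs of online vertices below \<open>n\<close>;
  \<open>Suc i = n\<close> closes a run cut off by the end.\<close>

definition runends :: "nat set \<Rightarrow> nat set" where
  "runends H = {i. i < n \<and> i \<notin> H \<and> (Suc i = n \<or> Suc i \<in> H)}"

lemma lverts_G [simp]: "lverts G = {..<n + m * s}"
  and rverts_G [simp]: "rverts G = {..<m + n}"
  and weight_G [simp]: "weight G = wt"
  by (simp_all add: G_def)

lemma block_subset: "j < m \<Longrightarrow> block j \<subseteq> {n..<n + m * s}"
proof -
  assume "j < m"
  then have "Suc j * s \<le> m * s" by (intro mult_le_mono1) simp
  then show ?thesis by (auto simp: block_def)
qed

lemma mem_edges_G: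
  "(i, j) \<in> edges G \<longleftrightarrow> i < n \<and> (j < m \<or> j = m + i) \<or> j < m \<and> i \<in> block j"
  by (simp add: G_def)

lemma edges_G_left: "i < n \<Longrightarrow> (i, j) \<in> edges G \<longleftrightarrow> j < m \<or> j = m + i"
  and edges_G_right: "n \<le> i \<Longrightarrow> (i, j) \<in> edges G \<longleftrightarrow> j < m \<and> i \<in> block j"
  using block_subset by (auto simp: mem_edges_G)

lemma wt_bounds: "1 \<le> wt e" "wt e \<le> 1 + \<delta>"
proof -
  have "\<delta> / real (Suc k) \<le> \<delta> / 1" for k
    using delta_pos by (intro divide_left_mono) auto
  then show "1 \<le> wt e" "wt e \<le> 1 + \<delta>"
    using delta_pos by (auto simp: wt_def simp del: of_nat_Suc)
qed

lemma weighted_bipartite_G: "weighted_bipartite G"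
proof -
  have "0 \<le> wt e" for e using wt_bounds(1)[of e] by linarith
  then show ?thesis
    using block_subset unfolding weighted_bipartite_def by (force simp: mem_edges_G)
qed

text \<open>Decodes the lexicographic key. An edge at least as heavy as one of weight above 1 must
  itself start below \<open>n\<close>.\<close>

lemma wt_le_imp:
  assumes "i < n" "wt (i, j) \<le> wt (i', j')"
  shows "i' < i \<or> i' = i \<and> min j' m \<le> min j m"
proof -
  have pos: "1 < wt (i, j)" using assms(1) delta_pos by (simp add: wt_def del: of_nat_Suc)
  then have "i' < n" using assms(2) by (auto simp: wt_def split: if_splits)
  then have "\<delta> / real (Suc (i * Suc m + min j m)) \<le> \<delta> / real (Suc (i' * Suc m + min j' m))"
    using assms by (simp add: wt_def)
  then have "real (Suc (i' * Suc m + min j' m)) \<le> real (Suc (i * Suc m + min j m))"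
    using delta_pos by (simp add: field_simps del: of_nat_Suc mult_Suc_right)
  then have le: "i' * Suc m + min j' m \<le> i * Suc m + min j m" by linarith
  show ?thesis
  proof (cases "i < i'")
    case True
    then have "Suc i * Suc m \<le> i' * Suc m" by (intro mult_le_mono1) simp
    with le show ?thesis by simp
  next
    case False
    with le show ?thesis by (cases "i = i'") auto
  qed
qed

text \<open>A history vertex lies between any two run ends, so the counter strictly increases from
  one to the other; private targets differ by their index.\<close>

lemma inj_on_target_runends: "inj_on (target H) (runends H)"
proof (rule linorder_inj_onI')
  fix i i' assume i: "i \<in> runends H" "i' \<in> runends H" "i < i'"
  then have "Suc i \<in> H" by (auto simp: runends_def)
  moreover have "Suc i < i'"
    using i \<open>Suc i \<in> H\<close> by (auto simp: runends_def intro: le_neq_trans)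
  ultimately have "card (H \<inter> {..<Suc i}) < card (H \<inter> {..<i'})"
    by (intro card_below_strict_mono)
  moreover have "card (H \<inter> {..<i}) \<le> card (H \<inter> {..<Suc i})" by (intro card_mono) auto
  ultimately show "target H i \<noteq> target H i'" using i by (auto simp: target_def)
qed

text \<open>
  The online vertices between two consecutive history vertices all compete for the same core;
  the last one of such a run represents it.
\<close>

lemma card_below_image_le: "card ((\<lambda>i. card (H \<inter> {..<i})) ` ({..<n} - H)) \<le> card (runends H)"
proof -
  let ?c = "\<lambda>i. card (H \<inter> {..<i})"
  have fin: "finite (runends H)" by (simp add: runends_def)
  have "?c ` ({..<n} - H) \<subseteq> ?c ` runends H"
  proof safe
    fix i assume i: "i < n" "i \<notin> H"
    \<comment> \<open>The maximum of \<open>S\<close> ends the run of \<open>i\<close>: an online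
      successor below \<open>n\<close> would have the same count and so lie in \<open>S\<close> as
      well.\<close>
    define S where "S = {k \<in> {..<n} - H. ?c k = ?c i}"
    have S: "finite S" "i \<in> S" using i by (auto simp: S_def)
    define k where "k = Max S"
    have k: "k < n" "k \<notin> H" "?c k = ?c i"
      using Max_in[of S] S unfolding k_def[symmetric] by (auto simp: S_def)
    have "Suc k = n \<or> Suc k \<in> H"
    proof (rule ccontr)
      assume "\<not> (Suc k = n \<or> Suc k \<in> H)"
      moreover have "H \<inter> {..<Suc k} = H \<inter> {..<k}" using k by (auto simp: less_Suc_eq)
      ultimately have "Suc k \<in> S" using k by (simp add: S_def)
      then show False using Max_ge[OF S(1) \<open>Suc k \<in> S\<close>] unfolding k_def by linarith
    qed
    with k have "k \<in> runends H" by (simp add: runends_def)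
    with k show "?c i \<in> ?c ` runends H" by (metis imageI)
  qed
  then have "card (?c ` ({..<n} - H)) \<le> card (?c ` runends H)" using fin by (intro card_mono) auto
  also have "\<dots> \<le> card (runends H)" using fin by (rule card_image_le)
  finally show ?thesis .
qed

section \<open>Greedy and the online algorithm on the extremal graph\<close>

context
  fixes tb :: "((nat \<times> nat) \<times> (nat \<times> nat)) set"
  assumes tb: "linear_order tb"
begin

lemma greedy_edges: "greedy tb (induced G K) \<subseteq> {e \<in> edges G. fst e \<in> K}"
  and greedy_fst: "(i, j) \<in> greedy tb (induced G K) \<Longrightarrow> (i, j') \<in> greedy tb (induced G K) \<Longrightarrow> j = j'"
  and greedy_snd: "(i, j) \<in> greedy tb (induced G K) \<Longrightarrow> (i', j) \<in> greedy tb (induced G K) \<Longrightarrow> i = i'"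
  and greedy_block: "(i, j) \<in> edges G \<Longrightarrow> i \<in> K \<Longrightarrow>
    \<exists>i' j'. (i', j') \<in> greedy tb (induced G K) \<and> wt (i, j) \<le> wt (i', j') \<and> (i' = i \<or> j' = j)"
proof -
  have "finite (edges (induced G K))"
    using finite_edges[OF weighted_bipartite_G] by (simp add: edges_induced)
  note st = greedy_stable[OF this tb]
  show "greedy tb (induced G K) \<subseteq> {e \<in> edges G. fst e \<in> K}"
    using st(1) by (simp add: edges_induced)
  show "j = j'" if "(i, j) \<in> greedy tb (induced G K)" "(i, j') \<in> greedy tb (induced G K)"
    using inj_onD[OF st(2) _ that] by simp
  show "i = i'" if "(i, j) \<in> greedy tb (induced G K)" "(i', j) \<in> greedy tb (induced G K)"
    using inj_onD[OF st(3) _ that] by simp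
  show "\<exists>i' j'. (i', j') \<in> greedy tb (induced G K) \<and> wt (i, j) \<le> wt (i', j') \<and> (i' = i \<or> j' = j)"
    if "(i, j) \<in> edges G" "i \<in> K"
  proof -
    have "(i, j) \<in> edges (induced G K)" using that by (simp add: edges_induced)
    from st(4)[OF this] show ?thesis by fastforce
  qed
qed

text \<open>Strong induction on \<open>i\<close>: the edge from \<open>i\<close> to its target is
  chosen or blocked by another edge at least as heavy, and either kind of blocking contradicts the
  targets known for smaller vertices.\<close>

lemma greedy_target:
  assumes "i \<in> K" "i < n"
  shows "(i, target K i) \<in> greedy tb (induced G K)"
  using assms
proof (induction i rule: less_induct)
  case (less i)
  let ?M = "greedy tb (induced G K)" and ?c = "\<lambda>i. card (K \<inter> {..<i})"
  have "(i, target K i) \<in> edges G"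
    using less.prems by (simp add: edges_G_left target_def)
  then obtain i' j' where f: "(i', j') \<in> ?M" "wt (i, target K i) \<le> wt (i', j')"
      "i' = i \<or> j' = target K i"
    using greedy_block less.prems by blast
  have fE: "(i', j') \<in> edges G" "i' \<in> K" using subsetD[OF greedy_edges f(1)] by auto
  have ord: "i' < i \<or> i' = i \<and> min j' m \<le> min (target K i) m"
    using wt_le_imp less.prems f(2) by blast
  show ?case
  proof (cases "j' = target K i")
    case True
    \<comment> \<open>An earlier \<open>i'\<close> holding this right vertex would have it as its
      own target, but the counts differ and a private vertex has only one neighbour.\<close>
    have "i' = i"
    proof (rule ccontr)
      assume "i' \<noteq> i"
      with ord have "i' < i" by simp
      then have "i' < n" using less.prems by simp
      have "(i', target K i') \<in> ?M" using less.IH \<open>i' < i\<close> fE \<open>i' < n\<close> by blast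
      then have "target K i' = target K i" using greedy_fst f(1) True by blast
      moreover have "?c i' < ?c i" using card_below_strict_mono fE \<open>i' < i\<close> by blast
      ultimately show False using \<open>i' < i\<close> fE True \<open>i' < n\<close>
        by (auto simp: target_def edges_G_left split: if_splits)
    qed
    with f True show ?thesis by simp
  next
    case False
    with f have [simp]: "i' = i" by simp
    have "j' < m" "j' < ?c i"
      using ord False fE less.prems
      by (auto simp: target_def edges_G_left min_def split: if_splits)
    \<comment> \<open>The better core \<open>j'\<close> is already held by the vertex of
      \<open>K\<close> with exactly \<open>j'\<close> predecessors in \<open>K\<close>.\<close>
    then obtain k where k: "k \<in> K" "k < i" "?c k = j'" using ex_card_below by blast
    then have "target K k = j'" using \<open>j' < m\<close> by (simp add: target_def)
    with less.IH[of k] k less.prems have "(k, j') \<in> ?M" by simp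
    then have "k = i" using greedy_snd f(1) by auto
    with k show ?thesis by simp
  qed
qed

lemma candidates_left:
  assumes "i < n"
  shows "snd ` candidates tb G H i = {target H i}"
proof -
  have "insert i H \<inter> {..<i} = H \<inter> {..<i}" by auto
  then have "target (insert i H) i = target H i" by (simp add: target_def)
  with greedy_target[of i "insert i H"] assms
  have "(i, target H i) \<in> greedy tb (induced G (insert i H))" by simp
  then show ?thesis
    unfolding candidates_def by (force dest: greedy_fst)
qed

text \<open>The history vertices below \<open>n\<close> occupy the first cores, so a block vertex
  can only get one of the rest.\<close>

lemma candidates_right:
  assumes "n \<le> x"
  shows "snd ` candidates tb G H x \<subseteq> {card (H \<inter> {..<n})..<m}"
proof safe
  fix a j assume "(a, j) \<in> candidates tb G H x"
  then have M: "(x, j) \<in> greedy tb (induced G (insert x H))" by (auto simp: candidates_def)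
  then have "j < m" using greedy_edges assms edges_G_right by fastforce
  moreover have "\<not> j < card (H \<inter> {..<n})"
  proof
    assume "j < card (H \<inter> {..<n})"
    then obtain i where i: "i \<in> H" "i < n" "card (H \<inter> {..<i}) = j" using ex_card_below by blast
    have "insert x H \<inter> {..<i} = H \<inter> {..<i}" using i assms by auto
    then have "target (insert x H) i = j" using i \<open>j < m\<close> by (simp add: target_def)
    with greedy_target[of i "insert x H"] i
    have "(i, j) \<in> greedy tb (induced G (insert x H))" by simp
    with M have "i = x" using greedy_snd by blast
    with i assms show False by simp
  qed
  ultimately show "snd (a, j) \<in> {card (H \<inter> {..<n})..<m}" by simp
qed

text \<open>The lower bound counts the distinct targets of run ends. The upper bound adds up one
  core per run, at most \<open>n\<close> private vertices once the history exhausts the cores, and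
  the cores that the history leaves to the blocks.\<close>

lemma card_alg_bounds:
  assumes "set us = lverts G - H"
  shows "card (runends H) \<le> card (alg_matching tb G H us)"
    and "card (alg_matching tb G H us)
      \<le> card (runends H) + n * of_bool (m \<le> card (H \<inter> {..<n})) + (m - card (H \<inter> {..<n}))"
proof -
  define R where "R = (\<Union>u\<in>set us. snd ` candidates tb G H u)"
  let ?c = "\<lambda>i. card (H \<inter> {..<i})"
  have card_eq: "card (alg_matching tb G H us) = card R"
    unfolding R_def by (rule card_alg_matching[OF weighted_bipartite_G tb])
  have left: "target H i \<in> R" if "i < n" "i \<notin> H" for i
  proof -
    have "i \<in> set us" using that assms by simp
    moreover have "target H i \<in> snd ` candidates tb G H i" using that by (simp add: candidates_left)
    ultimately show ?thesis unfolding R_def by (rule UN_I)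
  qed
  have "R \<subseteq> target H ` ({..<n} - H) \<union> {?c n..<m}"
  proof
    fix r assume "r \<in> R"
    then obtain u where u: "u \<in> lverts G" "u \<notin> H" "r \<in> snd ` candidates tb G H u"
      using assms by (auto simp: R_def)
    show "r \<in> target H ` ({..<n} - H) \<union> {?c n..<m}"
    proof (cases "u < n")
      case True
      with u show ?thesis by (auto simp: candidates_left)
    next
      case False
      with u candidates_right[of u H] show ?thesis by auto
    qed
  qed
  moreover have "target H ` ({..<n} - H)
      \<subseteq> ?c ` ({..<n} - H) \<union> (if m \<le> ?c n then (+) m ` {..<n} else {})"
  proof safe
    fix i assume i: "i < n" "i \<notin> H" "target H i \<notin> (if m \<le> ?c n then (+) m ` {..<n} else {})"
    have "?c i \<le> ?c n" using i by (intro card_mono) auto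
    with i have "?c i < m" by (auto simp: target_def split: if_splits)
    with i show "target H i \<in> ?c ` ({..<n} - H)" by (auto simp: target_def)
  qed
  ultimately have R: "R \<subseteq> ?c ` ({..<n} - H) \<union> (if m \<le> ?c n then (+) m ` {..<n} else {}) \<union> {?c n..<m}"
    by blast
  then have "finite R" by (rule finite_subset) auto
  have "card (runends H) = card (target H ` runends H)"
    by (simp add: card_image inj_on_target_runends)
  also have "\<dots> \<le> card R"
    using left \<open>finite R\<close> by (intro card_mono) (auto simp: runends_def)
  finally show "card (runends H) \<le> card (alg_matching tb G H us)" by (simp add: card_eq)
  have "card R \<le> card (?c ` ({..<n} - H) \<union> (if m \<le> ?c n then (+) m ` {..<n} else {}) \<union> {?c n..<m})"
    using R by (intro card_mono) auto
  also have "\<dots> \<le> card (?c ` ({..<n} - H)) + card (if m \<le> ?c n then (+) m ` {..<n} else {})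
      + card {?c n..<m}"
    by (meson add_mono card_Un_le le_refl order_trans)
  also have "\<dots> \<le> card (runends H) + n * of_bool (m \<le> ?c n) + (m - ?c n)"
    using card_below_image_le by (intro add_mono) (auto simp: card_image)
  finally show "card (alg_matching tb G H us)
      \<le> card (runends H) + n * of_bool (m \<le> ?c n) + (m - ?c n)" by (simp add: card_eq)
qed

end

section \<open>The offline optimum\<close>

lemma sum_wt_bounds:
  assumes "finite M"
  shows "real (card M) \<le> sum wt M" "sum wt M \<le> (1 + \<delta>) * card M"
  using sum_mono[of M "\<lambda>_. 1" wt] sum_mono[of M wt "\<lambda>_. 1 + \<delta>"] wt_bounds
  by (auto simp: mult.commute)

lemma finite_matching_weights: "finite {sum wt M | M. matching (induced G U) M}"
proof -
  have "finite (Pow (edges G))" using finite_edges[OF weighted_bipartite_G] by simp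
  then have "finite {M. matching (induced G U) M}"
    by (rule rev_finite_subset) (auto simp: matching_def edges_induced)
  then show ?thesis by simp
qed

text \<open>Edges at vertices below \<open>n\<close> are charged to their left endpoints, block
  edges to the cores they cover.\<close>

lemma opt_upper:
  "max_matching_weight (induced G (lverts G - H)) \<le> (1 + \<delta>) * (card ({..<n} - H) + m)"
proof -
  have "sum wt M \<le> (1 + \<delta>) * (card ({..<n} - H) + m)"
    if M: "matching (induced G (lverts G - H)) M" for M
  proof -
    have sub: "M \<subseteq> edges G" "fst ` M \<subseteq> lverts G - H" and inj: "inj_on fst M" "inj_on snd M"
      using M by (auto simp: matching_def edges_induced)
    have fin: "finite M" using sub finite_edges[OF weighted_bipartite_G] finite_subset by blast
    define A where "A = {e \<in> M. fst e < n}"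
    define B where "B = {e \<in> M. \<not> fst e < n}"
    have "card A = card (fst ` A)"
      by (intro card_image[symmetric] inj_on_subset[OF inj(1)]) (auto simp: A_def)
    also have "\<dots> \<le> card ({..<n} - H)"
      using sub by (intro card_mono) (auto simp: A_def)
    finally have "card A \<le> card ({..<n} - H)" .
    moreover have "card B = card (snd ` B)"
      by (intro card_image[symmetric] inj_on_subset[OF inj(2)]) (auto simp: B_def)
    moreover have "card (snd ` B) \<le> card {..<m}"
      using sub by (intro card_mono) (auto simp: B_def edges_G_right)
    moreover have "card M = card A + card B"
      unfolding A_def B_def using fin by (subst card_Un_disjoint[symmetric]) (auto intro: arg_cong[of _ _ card])
    ultimately have "card M \<le> card ({..<n} - H) + m" by simp
    then have "(1 + \<delta>) * card M \<le> (1 + \<delta>) * (card ({..<n} - H) + m)"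
      using delta_pos by (intro mult_left_mono) linarith+
    with sum_wt_bounds(2)[OF fin] show ?thesis by linarith
  qed
  moreover have "matching (induced G (lverts G - H)) {}" by (simp add: matching_def)
  ultimately show ?thesis
    unfolding max_matching_weight_def using finite_matching_weights by (subst Max_le_iff) auto
qed

lemma block_disjoint: "x \<in> block i \<Longrightarrow> x \<in> block j \<Longrightarrow> i = j"
proof -
  have "i = (x - n) div s" if "x \<in> block i" for i
  proof -
    have "i * s \<le> x - n" "x - n < Suc i * s" using that by (auto simp: block_def)
    then show ?thesis by (metis div_nat_eqI mult.commute)
  qed
  then show "x \<in> block i \<Longrightarrow> x \<in> block j \<Longrightarrow> i = j" by blast
qed

text \<open>Witness: each online vertex below \<open>n\<close> takes its private vertex, and each
  core takes an online vertex of its block if there is one.\<close>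

lemma opt_lower:
  "card ({..<n} - H) + card {j \<in> {..<m}. \<not> block j \<subseteq> H}
    \<le> max_matching_weight (induced G (lverts G - H))"
proof -
  define J where "J = {j \<in> {..<m}. \<not> block j \<subseteq> H}"
  define x where "x j = (SOME l. l \<in> block j \<and> l \<notin> H)" for j
  have x: "x j \<in> block j" "x j \<notin> H" if "j \<in> J" for j
  proof -
    have "\<exists>l. l \<in> block j \<and> l \<notin> H" using that by (auto simp: J_def)
    from someI_ex[OF this] show "x j \<in> block j" "x j \<notin> H" by (auto simp: x_def)
  qed
  have xn: "n \<le> x j" "x j < n + m * s" if "j \<in> J" for j
    using x[OF that] block_subset[of j] that by (auto simp: J_def)
  define M where "M = (\<lambda>i. (i, m + i)) ` ({..<n} - H) \<union> (\<lambda>j. (x j, j)) ` J"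
  have "matching (induced G (lverts G - H)) M"
    unfolding matching_def
  proof (intro conjI)
    show "M \<subseteq> edges (induced G (lverts G - H))"
    proof -
      have "(x j, j) \<in> edges G" if "j \<in> J" for j
        using x[OF that] xn[OF that] that by (simp add: edges_G_right J_def)
      then show ?thesis using x xn by (auto simp: M_def edges_induced edges_G_left)
    qed
    have "j = j'" if "j \<in> J" "j' \<in> J" "x j = x j'" for j j'
      using block_disjoint x(1) that by metis
    moreover have "i \<noteq> x j" "x j \<noteq> i" if "i < n" "j \<in> J" for i j
      using xn(1)[OF that(2)] that(1) by auto
    ultimately show "inj_on fst M"
      unfolding M_def inj_on_def by auto
    show "inj_on snd M"
      by (auto simp: M_def inj_on_def J_def)
  qed
  then have "sum wt M \<in> {sum wt M | M. matching (induced G (lverts G - H)) M}" by blast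
  then have "sum wt M \<le> max_matching_weight (induced G (lverts G - H))"
    unfolding max_matching_weight_def using finite_matching_weights by (auto intro: Max_ge)
  moreover have "card M = card ({..<n} - H) + card J"
  proof -
    have "card M = card ((\<lambda>i. (i, m + i)) ` ({..<n} - H)) + card ((\<lambda>j. (x j, j)) ` J)"
      unfolding M_def by (intro card_Un_disjoint) (auto simp: J_def)
    then show ?thesis by (simp add: card_image inj_on_def)
  qed
  moreover have "finite M" by (simp add: M_def J_def)
  ultimately show ?thesis using sum_wt_bounds(1)[of M] unfolding J_def by linarith
qed

subsection \<open>Expected weights\<close>

context
  fixes p :: real
  assumes p: "0 \<le> p" "p \<le> 1"
begin

abbreviation E :: "(nat set \<Rightarrow> real) \<Rightarrow> real" where
  "E \<equiv> measure_pmf.expectation (history_pmf p G)"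

lemma integrable_G [simp]: "integrable (measure_pmf (history_pmf p G)) (f :: nat set \<Rightarrow> real)"
  by (simp add: integrable_history_pmf)

lemmas E_card = expectation_card_Collect[of G _ p, OF finite_lessThan[of "n + m * s", folded lverts_G]]
lemmas E_mono = expectation_history_mono[of G _ _ p, OF finite_lessThan[of "n + m * s", folded lverts_G]]
lemmas E_pattern = expectation_history_pattern[of G p, OF finite_lessThan[of "n + m * s", folded lverts_G] p]

lemma E_offline: "E (\<lambda>H. card ({..<n} - H)) = n * (1 - p)"
proof -
  have "{..<n} - H = {i \<in> {..<n}. {} \<subseteq> H \<and> {i} \<inter> H = {}}" for H by auto
  then have "E (\<lambda>H. card ({..<n} - H)) = (\<Sum>i<n. E (\<lambda>H. of_bool ({} \<subseteq> H \<and> {i} \<inter> H = {})))"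
    by (simp only: E_card[OF finite_lessThan])
  also have "\<dots> = (\<Sum>i<n. 1 - p)"
    by (intro sum.cong refl, subst E_pattern) auto
  finally show ?thesis by simp
qed

lemma E_blocks: "E (\<lambda>H. card {j \<in> {..<m}. \<not> block j \<subseteq> H}) = m * (1 - p ^ s)"
proof -
  have "E (\<lambda>H. of_bool (\<not> block j \<subseteq> H)) = 1 - p ^ s" if "j < m" for j
  proof -
    have "E (\<lambda>H. of_bool (\<not> block j \<subseteq> H)) = E (\<lambda>H. 1 - of_bool (block j \<subseteq> H \<and> {} \<inter> H = {}))"
      by (intro Bochner_Integration.integral_cong) auto
    also have "\<dots> = 1 - E (\<lambda>H. of_bool (block j \<subseteq> H \<and> {} \<inter> H = {}))"
      by (subst Bochner_Integration.integral_diff) simp_all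
    also have "\<dots> = 1 - p ^ s"
      using block_subset[OF that] by (subst E_pattern) (auto simp: block_def)
    finally show ?thesis .
  qed
  then show ?thesis by (subst E_card) simp_all
qed

text \<open>A vertex ends a run if it is online and its successor is in the history; for
  \<open>n - 1\<close> being online suffices, hence the extra \<open>1 - p\<close>.\<close>

lemma E_runends:
  assumes "0 < n"
  shows "E (\<lambda>H. card (runends H)) = (real n - 1) * (p * (1 - p)) + (1 - p)"
proof -
  obtain n' where n': "n = Suc n'" using assms gr0_implies_Suc by blast
  have run: "runends H = {i \<in> {..<n}. (if Suc i = n then {} else {Suc i}) \<subseteq> H \<and> {i} \<inter> H = {}}" for H
    by (auto simp: runends_def split: if_splits)
  have "E (\<lambda>H. card (runends H))
      = (\<Sum>i<n. E (\<lambda>H. of_bool ((if Suc i = n then {} else {Suc i}) \<subseteq> H \<and> {i} \<inter> H = {})))"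
    unfolding run by (rule E_card) simp
  also have "\<dots> = (\<Sum>i<n. if Suc i = n then 1 - p else p * (1 - p))"
    by (intro sum.cong refl, subst E_pattern) auto
  also have "\<dots> = (\<Sum>i<n'. if Suc i = n then 1 - p else p * (1 - p)) + (1 - p)"
    by (simp add: n')
  also have "(\<Sum>i<n'. if Suc i = n then 1 - p else p * (1 - p)) = (\<Sum>i<n'. p * (1 - p))"
    by (intro sum.cong refl) (auto simp: n')
  finally show ?thesis by (simp add: n')
qed

lemma expected_opt_bounds:
  "n * (1 - p) + m * (1 - p ^ s) \<le> expected_opt p G"
  "expected_opt p G \<le> (1 + \<delta>) * (n * (1 - p) + m)"
proof -
  have "n * (1 - p) + m * (1 - p ^ s)
      = E (\<lambda>H. real (card ({..<n} - H)) + real (card {j \<in> {..<m}. \<not> block j \<subseteq> H}))"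
    by (simp only: Bochner_Integration.integral_add[OF integrable_G integrable_G] E_offline E_blocks)
  also have "\<dots> \<le> expected_opt p G"
    unfolding expected_opt_def using opt_lower by (intro E_mono) simp
  finally show "n * (1 - p) + m * (1 - p ^ s) \<le> expected_opt p G" .
  have "expected_opt p G \<le> E (\<lambda>H. (1 + \<delta>) * (real (card ({..<n} - H)) + m))"
    unfolding expected_opt_def using opt_upper by (intro E_mono) simp
  also have "\<dots> = (1 + \<delta>) * (E (\<lambda>H. real (card ({..<n} - H))) + m)"
    by (subst integral_mult_right_zero, subst Bochner_Integration.integral_add) simp_all
  finally show "expected_opt p G \<le> (1 + \<delta>) * (n * (1 - p) + m)" by (simp only: E_offline)
qed

lemma E_variance: "E (\<lambda>H. (real (card (H \<inter> {..<n})) - p * n)\<^sup>2) = n * (p * (1 - p))"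
  using history_variance[of G p "{..<n}"] p by simp

text \<open>
  The error terms are linear in the squared deviation of the number of history vertices, so that
  only its variance is needed.
\<close>

lemma expected_alg_bounds:
  fixes d :: real
  assumes tb: "linear_order tb" and \<sigma>: "\<sigma> \<in> adversaries G" and "0 < n"
    and d: "0 < d" "p * n + d \<le> m" "m \<le> p * n + d + 1"
  shows "n * (p * (1 - p)) \<le> expected_alg tb p G \<sigma>"
    and "expected_alg tb p G \<sigma> \<le> (1 + \<delta>) * (n * (p * (1 - p)) + 2 * d + 2
      + (n / d\<^sup>2 + 1 / d) * (n * (p * (1 - p))))"
proof -
  let ?c = "\<lambda>H. real (card (H \<inter> {..<n}))"
  let ?v = "\<lambda>H. (?c H - p * n)\<^sup>2"
  let ?M = "\<lambda>H. alg_matching tb G H (\<sigma> H)"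
  have us: "set (\<sigma> H) = lverts G - H" if "H \<subseteq> lverts G" for H
    using \<sigma> that by (auto simp: adversaries_def PiE_def Pi_def dest: permutations_of_setD)
  have finM: "finite (?M H)" for H
    using alg_matching_properties(1)[OF weighted_bipartite_G tb] finite_edges[OF weighted_bipartite_G]
    by (rule finite_subset)
  have q: "0 \<le> p * (1 - p)" using p by simp
  have "n * (p * (1 - p)) \<le> (real n - 1) * (p * (1 - p)) + (1 - p)"
  proof -
    have "(real n - 1) * (p * (1 - p)) + (1 - p) - n * (p * (1 - p)) = (1 - p)\<^sup>2"
      by (simp add: power2_eq_square algebra_simps)
    then show ?thesis using zero_le_power2[of "1 - p"] by linarith
  qed
  also have "\<dots> = E (\<lambda>H. card (runends H))" using E_runends \<open>0 < n\<close> by simp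
  also have "\<dots> \<le> expected_alg tb p G \<sigma>"
    unfolding expected_alg_def weight_G
  proof (rule E_mono)
    fix H assume "H \<subseteq> lverts G"
    from card_alg_bounds(1)[OF tb us[OF this]] sum_wt_bounds(1)[OF finM, of H]
    show "real (card (runends H)) \<le> sum wt (?M H)" by linarith
  qed
  finally show "n * (p * (1 - p)) \<le> expected_alg tb p G \<sigma>" .
  have "expected_alg tb p G \<sigma>
      \<le> E (\<lambda>H. (1 + \<delta>) * (real (card (runends H)) + (2 * d + 1) + (n / d\<^sup>2 + 1 / d) * ?v H))"
    unfolding expected_alg_def weight_G
  proof (rule E_mono)
    fix H assume "H \<subseteq> lverts G"
    note le = card_alg_bounds(2)[OF tb us[OF this]]
    \<comment> \<open>Chebyshev in pointwise form: exhausting the cores forces a deviation of at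
      least \<open>d\<close> from the mean \<open>p * n\<close>.\<close>
    have "of_bool (m \<le> card (H \<inter> {..<n})) \<le> ?v H / d\<^sup>2"
    proof (cases "m \<le> card (H \<inter> {..<n})")
      case True
      with d have "d \<le> ?c H - p * n" by linarith
      then have "d\<^sup>2 \<le> ?v H" using d by (intro power_mono) auto
      with True d show ?thesis by simp
    qed simp
    then have 1: "n * of_bool (m \<le> card (H \<inter> {..<n})) \<le> n / d\<^sup>2 * ?v H"
      using mult_left_mono[of "of_bool (m \<le> card (H \<inter> {..<n}))" "?v H / d\<^sup>2" "real n"] by simp
    have "p * n - ?c H \<le> d + ?v H / d"
    proof -
      \<comment> \<open>With \<open>x\<close> for \<open>p * n - ?c H\<close>, the sum of squares is
        twice \<open>x^2 + d^2 - x * d\<close>; this trades the linear deviation for the squared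
        one.\<close>
      have "0 \<le> (p * n - ?c H - d)\<^sup>2 + (p * n - ?c H)\<^sup>2 + d\<^sup>2" by simp
      then have "(p * n - ?c H) * d \<le> d * d + ?v H"
        using d by (simp add: power2_eq_square algebra_simps)
      then have "p * n - ?c H \<le> (d * d + ?v H) / d" using d by (simp add: pos_le_divide_eq)
      then show ?thesis using d by (simp add: add_divide_distrib)
    qed
    then have "m - ?c H \<le> 2 * d + 1 + ?v H / d" using d(3) by argo
    \<comment> \<open>Subtraction on naturals truncates at 0, so the bound must also be
      nonnegative.\<close>
    moreover have "0 \<le> 2 * d + 1 + ?v H / d" using d(1) by simp
    ultimately have 2: "real (m - card (H \<inter> {..<n})) \<le> 2 * d + 1 + ?v H / d"
      by (cases "card (H \<inter> {..<n}) \<le> m") (simp_all add: of_nat_diff)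
    have "real (card (?M H)) \<le> real (card (runends H)) + real n * of_bool (m \<le> card (H \<inter> {..<n}))
        + real (m - card (H \<inter> {..<n}))"
      using of_nat_mono[OF le, where 'a = real] by (simp only: of_nat_add of_nat_mult of_nat_of_bool)
    also have "\<dots> \<le> card (runends H) + (2 * d + 1) + (n / d\<^sup>2 + 1 / d) * ?v H"
      using 1 2 by (simp add: distrib_right)
    finally have "(1 + \<delta>) * card (?M H)
        \<le> (1 + \<delta>) * (card (runends H) + (2 * d + 1) + (n / d\<^sup>2 + 1 / d) * ?v H)"
      using delta_pos by (intro mult_left_mono) auto
    with sum_wt_bounds(2)[OF finM, of H]
    show "sum wt (?M H) \<le> (1 + \<delta>) * (card (runends H) + (2 * d + 1) + (n / d\<^sup>2 + 1 / d) * ?v H)"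
      by linarith
  qed
  also have "\<dots> = (1 + \<delta>) * (E (\<lambda>H. card (runends H)) + (2 * d + 1) + (n / d\<^sup>2 + 1 / d) * E ?v)"
    by (simp only: integral_mult_right_zero Bochner_Integration.integral_add[OF integrable_G integrable_G]
        lebesgue_integral_const)
      simp
  also have "\<dots> \<le> (1 + \<delta>) * (n * (p * (1 - p)) + 2 * d + 2 + (n / d\<^sup>2 + 1 / d) * (n * (p * (1 - p))))"
    unfolding E_variance E_runends[OF \<open>0 < n\<close>]
  proof (intro mult_left_mono)
    show "(real n - 1) * (p * (1 - p)) + (1 - p) + (2 * d + 1) + (n / d\<^sup>2 + 1 / d) * (n * (p * (1 - p)))
      \<le> n * (p * (1 - p)) + 2 * d + 2 + (n / d\<^sup>2 + 1 / d) * (n * (p * (1 - p)))"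
      using mult_right_mono[of "real n - 1" "real n" "p * (1 - p)"] q p by simp
  qed (use delta_pos in simp)
  finally show "expected_alg tb p G \<sigma> \<le> (1 + \<delta>) * (n * (p * (1 - p)) + 2 * d + 2
      + (n / d\<^sup>2 + 1 / d) * (n * (p * (1 - p))))" .
qed

end

section \<open>Worst-case arrival order and passage to the limit\<close>

lemma competitive_ratio_attained:
  obtains \<sigma> where "\<sigma> \<in> adversaries G"
    "competitive_ratio tb p G = expected_alg tb p G \<sigma> / expected_opt p G"
proof -
  let ?S = "(\<lambda>\<sigma>. expected_alg tb p G \<sigma> / expected_opt p G) ` adversaries G"
  have "Min ?S \<in> ?S"
    using finite_adversaries[of G] adversaries_nonempty[of G] by (intro Min_in) auto
  then show ?thesis using that by (auto simp: competitive_ratio_def)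
qed

lemma num_verts_G: "num_verts G = 2 * n + m * s + m"
  by (simp add: num_verts_def)

end

theorem theorem3p2:
  fixes p :: real and tb :: "((nat \<times> nat) \<times> (nat \<times> nat)) set"
  assumes "0 \<le> p" "p \<le> 1/2"
    and "linear_order tb"
  shows "\<exists>G :: nat \<Rightarrow> (nat, nat) wbgraph.
           (\<forall>k. weighted_bipartite (G k)) \<and>
           strict_mono (\<lambda>k. num_verts (G k)) \<and>
           (\<forall>k. expected_opt p (G k) > 0) \<and>
           (\<lambda>k. competitive_ratio tb p (G k)) \<longlonglongrightarrow> p * (1 - p)"
proof -
  \<comment> \<open>The slack \<open>d\<close> lies strictly between the orders of
    \<open>sqrt n\<close> and \<open>n\<close>: both \<open>d / n\<close> and \<open>n / d^2\<close>
    tend to 0, as the error terms in \<open>expected_alg_bounds\<close> require.\<close>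
  define n where "n k = Suc k ^ 3" for k
  define d where "d k = Suc k ^ 2" for k
  define m where "m k = nat \<lceil>p * n k\<rceil> + d k" for k
  define \<delta> where "\<delta> k = 1 / real (Suc k)" for k
  define G where "G k = core_graph.G (n k) (m k) (Suc k) (\<delta> k)" for k
  define q where "q = p * (1 - p)"
  have p: "0 \<le> p" "p \<le> 1" and q: "0 \<le> q"
    using assms(1,2) by (auto simp: q_def)
  have loc: "core_graph (\<delta> k)" for k by unfold_locales (simp add: \<delta>_def)
  have n: "0 < n k" and d: "0 < d k" for k by (simp_all add: n_def d_def)
  have m: "p * n k + d k \<le> m k" "m k \<le> p * n k + d k + 1" for k
  proof -
    have "0 \<le> p * n k" using p by simp
    then have "real (nat \<lceil>p * n k\<rceil>) = \<lceil>p * n k\<rceil>" by simp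
    then show "p * n k + d k \<le> m k" "m k \<le> p * n k + d k + 1"
      unfolding m_def of_nat_add by linarith+
  qed
  have wb: "weighted_bipartite (G k)" for k
    unfolding G_def by (rule core_graph.weighted_bipartite_G[OF loc])
  have mono: "strict_mono (\<lambda>k. num_verts (G k))"
  proof (rule strict_mono_Suc_iff[THEN iffD2], rule allI)
    fix k
    have "n k < n (Suc k)" unfolding n_def by (intro power_strict_mono) auto
    moreover have "d k \<le> d (Suc k)" unfolding d_def by (intro power_mono) auto
    moreover have "p * n k \<le> p * n (Suc k)"
      using p \<open>n k < n (Suc k)\<close> by (intro mult_left_mono) auto
    ultimately have "m k \<le> m (Suc k)"
      unfolding m_def by (intro add_mono nat_mono ceiling_mono)
    moreover from this have "m k * Suc k \<le> m (Suc k) * Suc (Suc k)" by (intro mult_mono) auto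
    ultimately show "num_verts (G k) < num_verts (G (Suc k))"
      using \<open>n k < n (Suc k)\<close> unfolding G_def core_graph.num_verts_G[OF loc] by linarith
  qed
  \<comment> \<open>Passing from \<open>p\<close> to 1/2 gives an explicit error free of
    \<open>p\<close>. The exponent is the block size \<open>Suc k\<close> plus one, since
    \<open>n * (1 - p) + p * n * (1 - p ^ s) = n * (1 - p ^ Suc s)\<close>.\<close>
  have half: "p ^ Suc (Suc k) \<le> (1/2) ^ Suc (Suc k)" for k
    using assms by (intro power_mono) auto
  have opt_lo: "n k * (1 - (1/2) ^ Suc (Suc k)) \<le> expected_opt p (G k)" for k
  proof -
    have "n k * (1 - (1/2) ^ Suc (Suc k)) \<le> n k * (1 - p ^ Suc (Suc k))"
      using half[of k] by (intro mult_left_mono) auto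
    also have "\<dots> = n k * (1 - p) + p * n k * (1 - p ^ Suc k)" by (simp add: algebra_simps)
    also have "\<dots> \<le> n k * (1 - p) + m k * (1 - p ^ Suc k)"
      using m(1)[of k] p by (intro add_left_mono mult_right_mono) (auto intro: power_le_one simp del: power_Suc)
    also have "\<dots> \<le> expected_opt p (G k)"
      unfolding G_def by (rule core_graph.expected_opt_bounds(1)[OF loc p])
    finally show ?thesis .
  qed
  have opt_hi: "expected_opt p (G k) \<le> (1 + \<delta> k) * (n k + d k + 1)" for k
  proof -
    have "expected_opt p (G k) \<le> (1 + \<delta> k) * (n k * (1 - p) + m k)"
      unfolding G_def by (rule core_graph.expected_opt_bounds(2)[OF loc p])
    also have "\<dots> \<le> (1 + \<delta> k) * (n k + d k + 1)"
      using m(2)[of k] by (intro mult_left_mono) (auto simp: \<delta>_def algebra_simps)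
    finally show ?thesis .
  qed
  have lt1: "0 < 1 - (1/2 :: real) ^ Suc (Suc k)" for k
    using power_strict_decreasing[of 0 "Suc (Suc k)" "1/2 :: real"] by simp
  have opt_pos: "0 < expected_opt p (G k)" for k
  proof -
    have "0 < n k * (1 - (1/2 :: real) ^ Suc (Suc k))"
      using n lt1 by (intro mult_pos_pos) auto
    with opt_lo[of k] show ?thesis by linarith
  qed
  \<comment> \<open>\<open>lo\<close> and \<open>hi\<close> divide opposite bounds on ALG and OPT,
    in \<open>hi\<close> with the factor \<open>n\<close> cancelled. Neither mentions the adversary,
    so both apply to the minimising one.\<close>
  define lo where "lo k = q * (n k / ((1 + \<delta> k) * (n k + d k + 1)))" for k
  define hi where "hi k = (1 + \<delta> k) / (1 - (1/2) ^ Suc (Suc k)) *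
    (q + (2 * d k + 2) / n k + (n k / (d k)\<^sup>2 + 1 / d k) * q)" for k
  have bounds: "lo k \<le> competitive_ratio tb p (G k)" "competitive_ratio tb p (G k) \<le> hi k" for k
  proof -
    obtain \<sigma> where \<sigma>: "\<sigma> \<in> adversaries (G k)"
      "competitive_ratio tb p (G k) = expected_alg tb p (G k) \<sigma> / expected_opt p (G k)"
      unfolding G_def using core_graph.competitive_ratio_attained[OF loc] by blast
    have alg: "n k * q \<le> expected_alg tb p (G k) \<sigma>"
      "expected_alg tb p (G k) \<sigma> \<le> (1 + \<delta> k) * (n k * q + 2 * d k + 2
        + (n k / (d k)\<^sup>2 + 1 / d k) * (n k * q))"
      using core_graph.expected_alg_bounds[OF loc p assms(3) \<sigma>(1)[unfolded G_def] n, of "d k"] d m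
      unfolding q_def G_def by auto
    have "lo k = n k * q / ((1 + \<delta> k) * (n k + d k + 1))" by (simp add: lo_def)
    also have "\<dots> \<le> competitive_ratio tb p (G k)"
    proof -
      have "0 \<le> n k * q" using q by simp
      with alg(1) have "0 \<le> expected_alg tb p (G k) \<sigma>" by linarith
      then show ?thesis unfolding \<sigma>(2) by (rule frac_le[OF _ alg(1) opt_pos opt_hi])
    qed
    finally show "lo k \<le> competitive_ratio tb p (G k)" .
    have "competitive_ratio tb p (G k) \<le> ((1 + \<delta> k) * (n k * q + 2 * d k + 2
        + (n k / (d k)\<^sup>2 + 1 / d k) * (n k * q))) / (n k * (1 - (1/2) ^ Suc (Suc k)))"
      unfolding \<sigma>(2)
    proof (rule frac_le)
      show "0 \<le> (1 + \<delta> k) * (n k * q + 2 * d k + 2 + (n k / (d k)\<^sup>2 + 1 / d k) * (n k * q))"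
        using q by (intro mult_nonneg_nonneg add_nonneg_nonneg) (auto simp: \<delta>_def)
      show "0 < n k * (1 - (1/2 :: real) ^ Suc (Suc k))"
        using n lt1 by (intro mult_pos_pos) auto
    qed (use alg(2) opt_lo in auto)
    also have "\<dots> = hi k"
    proof -
      have "n k * q + 2 * d k + 2 + (n k / (d k)\<^sup>2 + 1 / d k) * (n k * q)
          = n k * (q + (2 * d k + 2) / n k + (n k / (d k)\<^sup>2 + 1 / d k) * q)"
        using n[of k] by (simp add: field_simps)
      then show ?thesis unfolding hi_def using n[of k] by simp
    qed
    finally show "competitive_ratio tb p (G k) \<le> hi k" .
  qed
  have "(\<lambda>k. n k / ((1 + \<delta> k) * (n k + d k + 1))) \<longlonglongrightarrow> 1"
    unfolding n_def d_def \<delta>_def of_nat_power of_nat_Suc by real_asymp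
  then have lo: "lo \<longlonglongrightarrow> q * 1"
    unfolding lo_def by (rule tendsto_mult_left)
  have lim1: "(\<lambda>k. (1 + \<delta> k) / (1 - (1/2) ^ Suc (Suc k))) \<longlonglongrightarrow> 1"
    unfolding \<delta>_def of_nat_Suc by real_asymp
  have lim2: "(\<lambda>k. (2 * d k + 2) / n k) \<longlonglongrightarrow> 0"
    unfolding n_def d_def of_nat_power of_nat_Suc of_nat_add of_nat_mult by real_asymp
  have lim3: "(\<lambda>k. n k / (d k)\<^sup>2 + 1 / d k) \<longlonglongrightarrow> 0"
    unfolding n_def d_def of_nat_power of_nat_Suc by real_asymp
  have hi: "hi \<longlonglongrightarrow> 1 * (q + 0 + 0 * q)"
    unfolding hi_def
    by (rule tendsto_mult[OF lim1 tendsto_add[OF tendsto_add[OF tendsto_const lim2]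
          tendsto_mult[OF lim3 tendsto_const]]])
  have "(\<lambda>k. competitive_ratio tb p (G k)) \<longlonglongrightarrow> q"
  proof (rule tendsto_sandwich)
    show "\<forall>\<^sub>F k in sequentially. lo k \<le> competitive_ratio tb p (G k)"
      using bounds(1) by (rule eventually_sequentiallyI)
    show "\<forall>\<^sub>F k in sequentially. competitive_ratio tb p (G k) \<le> hi k"
      using bounds(2) by (rule eventually_sequentiallyI)
    show "lo \<longlonglongrightarrow> q" using lo by (simp only: mult_1_right)
    show "hi \<longlonglongrightarrow> q" using hi by (simp only: mult_1_left mult_zero_left add_0_right)
  qed
  with wb mono opt_pos show ?thesis unfolding q_def by blast
qed

end
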